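(* Let $u=(u_m)_{m\ge0}$ be a positive sequence decreasing to zero, $C$ a positive number and $r$ a positive integer. Then for all sufficiently large $m$ and all positive integers $n$, $$\inf_{\hat f\in\mathcal{S}_n}\sup_{f\in\mathcal{C}(u,C,r)\cap\mathbb{H}_1}\mathbb{E}_f\|\hat f-f\|_{\mathbb{H}}^2\ \ge\ \left(\frac{Cu_{m+1}}2\right)^2\left(1-\frac{\sqrt5}{2m}Cu_{m+1}\right)^n,$$ and for any integer $m\ge r$ and all positive integers $n$, $$\sup_{f\in\mathcal{C}(u,C,r)\cap\mathbb{H}_1}\mathbb{E}_f\|\widehat f_{m,n}-f\|_{\mathbb{H}}^2\ \le\ (Cu_m)^2+\frac{2m^2}{n}.$$
   Context: Mixtures of discrete uniform distributions. $\Theta=\mathbb{N}=\{1,2,\dots\}$, $\mathcal{X}=\mathbb{Z}_+=\{0,1,\dots\}$, $\nu$ is counting measure on $\Theta$, $\mathbb{H}=\ell^2(\mathbb{N})$ (real), and $\mathbb{H}_1$ is the set of probability mass functions on $\mathbb{N}$. $\pi_\theta(k)=\theta^{-1}$ for $0\le k\le\theta-1$ and $0$ otherwise; for $f\in\mathbb{H}_1$, $\pi_f(k)=\sum_{\theta\ge1}\pi_\theta(k)f(\theta)$. $\mathbb{E}_f$ is expectation when $X_1,\dots,X_n$ are i.i.d. from $\pi_f$; $\mathcal{S}_n$ is the set of measurable functions from $\mathcal{X}^n$ to $\mathbb{H}$. The projection estimator is $\widehat f_{m,n}(k)=k\,(P_n\mathbf{1}_{k-1}-P_n\mathbf{1}_k)$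 for $1\le k\le m$ and $\widehat f_{m,n}(k)=0$ for $k>m$, where $P_n\mathbf{1}_k=\frac1n\#\{i\le n:X_i=k\}$. The smoothness class is $$\mathcal{C}(u,C,r)=\Big\{f\in\ell^2(\mathbb{N}):\sum_{k>m}f^2(k)\le C^2u_m^2\text{ for all }m\ge r\Big\}.$$ *)

theory Defs
  imports "HOL-Probability.Probability"
begin

text \<open>
  The real Hilbert space of square-summable sequences indexed by \<open>1, 2, \<dots>\<close>. A sequence is
  a function on \<^typ>\<open>nat\<close> whose unused value at \<open>0\<close> is fixed to \<open>0\<close>, so that distinct elements
  differ at some index \<open>k \<ge> 1\<close>.
\<close>

typedef ell2 = "{f :: nat \<Rightarrow> real. f 0 = 0 \<and> (\<lambda>k. (f k)\<^sup>2) summable_on {1..}}"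
  morphisms coord Abs_ell2
  by (rule exI[of _ "\<lambda>_. 0"]) simp

setup_lifting type_definition_ell2

lemma ell2_mult_summable:
  fixes f g :: "nat \<Rightarrow> real"
  assumes "(\<lambda>k. (f k)\<^sup>2) summable_on A" "(\<lambda>k. (g k)\<^sup>2) summable_on A"
  shows "(\<lambda>k. f k * g k) summable_on A"
proof -
  have "(\<lambda>k. norm (f k * g k)) summable_on A"
  proof (rule summable_on_comparison_test)
    show "(\<lambda>k. (f k)\<^sup>2 + (g k)\<^sup>2) summable_on A"
      by (intro summable_on_add assms)
    fix k
    have "2 * \<bar>f k\<bar> * \<bar>g k\<bar> \<le> \<bar>f k\<bar>\<^sup>2 + \<bar>g k\<bar>\<^sup>2"
      by (rule sum_squares_bound)
    moreover have "0 \<le> \<bar>f k\<bar> * \<bar>g k\<bar>" by simp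
    ultimately have "\<bar>f k\<bar> * \<bar>g k\<bar> \<le> \<bar>f k\<bar>\<^sup>2 + \<bar>g k\<bar>\<^sup>2" by linarith
    then show "norm (f k * g k) \<le> (f k)\<^sup>2 + (g k)\<^sup>2" by (simp add: abs_mult)
  qed simp
  then show ?thesis by (rule abs_summable_summable)
qed

lemma coord_0 [simp]: "coord x 0 = 0"
  and coord_summable: "(\<lambda>k. (coord x k)\<^sup>2) summable_on {1..}"
  using coord[of x] by auto

lemma coord_mult_summable: "(\<lambda>k. coord x k * coord y k) summable_on {1..}"
  by (intro ell2_mult_summable coord_summable)

instantiation ell2 :: real_inner
begin

lift_definition zero_ell2 :: ell2 is "\<lambda>_. 0" by simp

lift_definition uminus_ell2 :: "ell2 \<Rightarrow> ell2" is "\<lambda>f k. - f k" by simp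

lift_definition plus_ell2 :: "ell2 \<Rightarrow> ell2 \<Rightarrow> ell2" is "\<lambda>f g k. f k + g k"
proof -
  fix f g :: "nat \<Rightarrow> real"
  assume *: "f 0 = 0 \<and> (\<lambda>k. (f k)\<^sup>2) summable_on {1..}"
    "g 0 = 0 \<and> (\<lambda>k. (g k)\<^sup>2) summable_on {1..}"
  then have "(\<lambda>k. (f k)\<^sup>2 + (g k)\<^sup>2 + 2 * (f k * g k)) summable_on {1..}"
    by (intro summable_on_add summable_on_cmult_right ell2_mult_summable) auto
  with * show "f 0 + g 0 = 0 \<and> (\<lambda>k. (f k + g k)\<^sup>2) summable_on {1..}"
    by (simp add: power2_sum mult.assoc)
qed

lift_definition scaleR_ell2 :: "real \<Rightarrow> ell2 \<Rightarrow> ell2" is "\<lambda>c f k. c * f k"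
  by (simp add: power_mult_distrib summable_on_cmult_right)

definition minus_ell2 :: "ell2 \<Rightarrow> ell2 \<Rightarrow> ell2" where
  "minus_ell2 x y = x + - y"

definition inner_ell2 :: "ell2 \<Rightarrow> ell2 \<Rightarrow> real" where
  "inner_ell2 x y = (\<Sum>\<^sub>\<infinity>k\<in>{1..}. coord x k * coord y k)"

definition norm_ell2 :: "ell2 \<Rightarrow> real" where
  "norm_ell2 x = sqrt (inner x x)"

definition sgn_ell2 :: "ell2 \<Rightarrow> ell2" where
  "sgn_ell2 x = scaleR (inverse (norm x)) x"

definition dist_ell2 :: "ell2 \<Rightarrow> ell2 \<Rightarrow> real" where
  "dist_ell2 x y = norm (x - y)"

definition uniformity_ell2 :: "(ell2 \<times> ell2) filter" where
  "uniformity_ell2 = (INF e\<in>{0<..}. principal {(x, y). dist x y < e})"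

definition open_ell2 :: "ell2 set \<Rightarrow> bool" where
  "open_ell2 U = (\<forall>x\<in>U. \<forall>\<^sub>F (x', y) in uniformity. x' = x \<longrightarrow> y \<in> U)"

instance
proof
  fix x y z :: ell2 and a b :: real and U :: "ell2 set"
  show "x + y + z = x + (y + z)" by transfer (simp add: add.assoc)
  show "x + y = y + x" by transfer (simp add: add.commute)
  show "0 + x = x" by transfer simp
  show "- x + x = 0" by transfer simp
  show "x - y = x + - y" by (fact minus_ell2_def)
  show "a *\<^sub>R (x + y) = a *\<^sub>R x + a *\<^sub>R y" by transfer (simp add: algebra_simps)
  show "(a + b) *\<^sub>R x = a *\<^sub>R x + b *\<^sub>R x" by transfer (simp add: algebra_simps)
  show "a *\<^sub>R b *\<^sub>R x = (a * b) *\<^sub>R x" by transfer (simp add: algebra_simps)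
  show "1 *\<^sub>R x = x" by transfer simp
  show "sgn x = scaleR (inverse (norm x)) x" by (fact sgn_ell2_def)
  show "dist x y = norm (x - y)" by (fact dist_ell2_def)
  show "(uniformity :: (ell2 \<times> ell2) filter) = (INF e\<in>{0<..}. principal {(x, y). dist x y < e})"
    by (fact uniformity_ell2_def)
  show "open U = (\<forall>x\<in>U. \<forall>\<^sub>F (x', y) in uniformity. x' = x \<longrightarrow> y \<in> U)"
    by (fact open_ell2_def)
  show "norm x = sqrt (inner x x)" by (fact norm_ell2_def)
  show "inner x y = inner y x" by (simp add: inner_ell2_def mult.commute)
  show "inner (x + y) z = inner x z + inner y z"
    by (simp add: inner_ell2_def plus_ell2.rep_eq distrib_right infsum_add coord_mult_summable
        del: One_nat_def)
  show "inner (a *\<^sub>R x) y = a * inner x y"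
    by (simp add: inner_ell2_def scaleR_ell2.rep_eq mult.assoc infsum_cmult_right')
  show "0 \<le> inner x x" by (simp add: inner_ell2_def infsum_nonneg)
  show "(inner x x = 0) = (x = 0)"
  proof
    assume "inner x x = 0"
    then have "\<And>k. k \<in> {1..} \<Longrightarrow> coord x k * coord x k = 0"
      unfolding inner_ell2_def
      by (intro nonneg_infsum_le_0D[where A = "{1..}"] coord_mult_summable) auto
    then have "coord x k = 0" for k by (cases k) auto
    then show "x = 0" by (simp add: coord_inject[symmetric] zero_ell2.rep_eq fun_eq_iff)
  qed (simp add: inner_ell2_def zero_ell2.rep_eq)
qed

end

text \<open>
  \<open>unif_mass \<theta> k\<close> and \<open>mixture_mass f k\<close> are the masses \<open>\<pi>\<^sub>\<theta>(k)\<close> and \<open>\<pi>\<^sub>f(k)\<close>, with \<open>\<theta> \<ge> 1\<close> and \<open>k \<ge> 0\<close>.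
\<close>

definition unif_mass :: "nat \<Rightarrow> nat \<Rightarrow> real" where
  "unif_mass \<theta> k = (if k < \<theta> then 1 / real \<theta> else 0)"

definition mixing_pmfs :: "ell2 set" where
  "mixing_pmfs = {f. (\<forall>\<theta>\<ge>1. 0 \<le> coord f \<theta>) \<and> (coord f has_sum 1) {1..}}"

definition mixture_mass :: "ell2 \<Rightarrow> nat \<Rightarrow> real" where
  "mixture_mass f k = (\<Sum>\<^sub>\<infinity>\<theta>\<in>{1..}. unif_mass \<theta> k * coord f \<theta>)"

definition mixture :: "ell2 \<Rightarrow> nat measure" where
  "mixture f = density (count_space UNIV) (\<lambda>k. ennreal (mixture_mass f k))"

text \<open>
  A sample \<open>X\<^sub>1, \<dots>, X\<^sub>n\<close> is a function on the index set \<open>{..<n}\<close>; its law is the \<open>n\<close>-fold product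
  of the mixture.
\<close>

definition sample :: "nat \<Rightarrow> ell2 \<Rightarrow> (nat \<Rightarrow> nat) measure" where
  "sample n f = (\<Pi>\<^sub>M i\<in>{..<n}. mixture f)"

definition estimators :: "nat \<Rightarrow> ((nat \<Rightarrow> nat) \<Rightarrow> ell2) set" where
  "estimators n = (\<Pi>\<^sub>M i\<in>{..<n}. count_space UNIV) \<rightarrow>\<^sub>M borel"

text \<open>
  The risk takes values in the extended nonnegative reals, so an estimator of infinite risk
  counts as such in infima and suprema.
\<close>

definition risk :: "nat \<Rightarrow> ((nat \<Rightarrow> nat) \<Rightarrow> ell2) \<Rightarrow> ell2 \<Rightarrow> ennreal" where
  "risk n T f = (\<integral>\<^sup>+ x. ennreal ((norm (T x - f))\<^sup>2) \<partial>sample n f)"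

definition emp_freq :: "nat \<Rightarrow> (nat \<Rightarrow> nat) \<Rightarrow> nat \<Rightarrow> real" where
  "emp_freq n x k = real (card {i. i < n \<and> x i = k}) / real n"

lift_definition projection_estimator :: "nat \<Rightarrow> nat \<Rightarrow> (nat \<Rightarrow> nat) \<Rightarrow> ell2"
  is "\<lambda>m n x k. if 1 \<le> k \<and> k \<le> m then real k * (emp_freq n x (k - 1) - emp_freq n x k) else 0"
proof -
  fix m n :: nat and x
  let ?g = "\<lambda>k. if 1 \<le> k \<and> k \<le> m then real k * (emp_freq n x (k - 1) - emp_freq n x k) else 0"
  have "(\<lambda>k. (?g k)\<^sup>2) summable_on {1..m}" by simp
  also have "?this \<longleftrightarrow> (\<lambda>k. (?g k)\<^sup>2) summable_on {1..}"
    by (rule summable_on_cong_neutral) auto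
  finally show "?g 0 = 0 \<and> (\<lambda>k. (?g k)\<^sup>2) summable_on {1..}" by simp
qed

definition smoothness_class :: "(nat \<Rightarrow> real) \<Rightarrow> real \<Rightarrow> nat \<Rightarrow> ell2 set" where
  "smoothness_class u C r =
     {f. \<forall>m\<ge>r. (\<Sum>\<^sub>\<infinity>k\<in>{m<..}. (coord f k)\<^sup>2) \<le> C\<^sup>2 * (u m)\<^sup>2}"

end

theory Submission
  imports Defs
begin

text \<open>
  The lower bound is Le Cam's two-point method. Moving a mass \<open>b\<close> from \<open>m\<close> to \<open>m + 1\<close> changes
  \<open>f\<close> by \<open>sqrt 2 * b\<close> in norm, but changes \<open>\<pi>\<^sub>f\<close> only by \<open>b / (m + 1)\<close> in total variation, because the
  uniform distributions on \<open>m\<close> and \<open>m + 1\<close> points nearly coincide. The remaining mass sits at \<open>1\<close>,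
  where the smoothness class imposes no constraint. With \<open>b = C * u (m + 1) / sqrt 2\<close> the two
  mixing distributions are at distance \<open>C * u (m + 1)\<close>.

  The upper bound is a bias-variance decomposition based on \<open>f(k) = k * (\<pi>\<^sub>f(k-1) - \<pi>\<^sub>f(k))\<close>: the bias is the
  tail of \<open>f\<close> beyond \<open>m\<close>, and the variance of the \<open>k\<close>-th coordinate is at most
  \<open>k\<^sup>2 * (\<pi>\<^sub>f(k-1) + \<pi>\<^sub>f(k)) / n\<close>.
\<close>

section \<open>Densities on finite products\<close>

lemma nn_integral_PiM_density:
  fixes M :: "'i \<Rightarrow> 'a measure"
  assumes "finite I" and M: "\<And>i. sigma_finite_measure (M i)"
    and N: "\<And>i. sigma_finite_measure (density (M i) (p i))"
    and p[measurable]: "\<And>i. p i \<in> borel_measurable (M i)"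
    and "g \<in> borel_measurable (PiM I M)"
  shows "(\<integral>\<^sup>+ x. g x \<partial>PiM I (\<lambda>i. density (M i) (p i)))
           = (\<integral>\<^sup>+ x. (\<Prod>i\<in>I. p i (x i)) * g x \<partial>PiM I M)"
  using assms(1,5)
proof (induction I arbitrary: g)
  case empty
  then show ?case by (simp add: PiM_empty)
next
  case (insert i I)
  interpret M: product_sigma_finite M by (rule product_sigma_finite.intro) (rule M)
  interpret N: product_sigma_finite "\<lambda>i. density (M i) (p i)" by (rule product_sigma_finite.intro) (rule N)
  note insert.prems[measurable]
  note insert.hyps[simp]
  have sets: "sets (PiM I (\<lambda>i. density (M i) (p i))) = sets (PiM I M)" for I
    by (intro sets_PiM_cong) auto
  have prod[measurable]: "(\<lambda>x. \<Prod>j\<in>J. p j (x j)) \<in> borel_measurable (PiM J M)" for J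
    by (intro borel_measurable_prod_ennreal measurable_compose[OF _ p] measurable_component_singleton)
  have upd: "(\<lambda>x. g (x(i := y))) \<in> borel_measurable (PiM I M)" if "y \<in> space (M i)" for y
    using that by (intro measurable_compose[OF _ insert.prems] measurable_fun_upd[where J = I]) auto
  interpret fin: finite_product_sigma_finite M I by unfold_locales simp
  \<comment> \<open>Tonelli peels off coordinate \<open>i\<close>. For each fixed value
    \<open>y\<close> of it the induction hypothesis applies to the section of \<open>g\<close>, and
    the one-dimensional density formula then brings out \<open>p i y\<close>.\<close>
  have "(\<integral>\<^sup>+ x. g x \<partial>PiM (insert i I) (\<lambda>i. density (M i) (p i)))
      = (\<integral>\<^sup>+ y. \<integral>\<^sup>+ x. g (x(i := y)) \<partial>PiM I (\<lambda>i. density (M i) (p i)) \<partial>density (M i) (p i))"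
    using insert.prems by (intro N.product_nn_integral_insert_rev)
      (auto simp: measurable_cong_sets[OF sets refl])
  also have "\<dots> = (\<integral>\<^sup>+ y. \<integral>\<^sup>+ x. (\<Prod>j\<in>I. p j (x j)) * g (x(i := y)) \<partial>PiM I M \<partial>density (M i) (p i))"
    by (intro nn_integral_cong insert.IH upd) simp
  also have "\<dots> = (\<integral>\<^sup>+ y. p i y * (\<integral>\<^sup>+ x. (\<Prod>j\<in>I. p j (x j)) * g (x(i := y)) \<partial>PiM I M) \<partial>M i)"
    by (intro nn_integral_density fin.borel_measurable_nn_integral) measurable
  also have "\<dots> = (\<integral>\<^sup>+ y. \<integral>\<^sup>+ x. p i y * ((\<Prod>j\<in>I. p j (x j)) * g (x(i := y))) \<partial>PiM I M \<partial>M i)"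
    by (intro nn_integral_cong nn_integral_cmult[symmetric] borel_measurable_times_ennreal upd) measurable
  also have "\<dots> = (\<integral>\<^sup>+ y. \<integral>\<^sup>+ x. (\<Prod>j\<in>insert i I. p j ((x(i := y)) j)) * g (x(i := y)) \<partial>PiM I M \<partial>M i)"
  proof (intro nn_integral_cong)
    fix x y
    have "(\<Prod>j\<in>I. p j ((x(i := y)) j)) = (\<Prod>j\<in>I. p j (x j))"
      using insert.hyps by (intro prod.cong) auto
    then show "p i y * ((\<Prod>j\<in>I. p j (x j)) * g (x(i := y)))
        = (\<Prod>j\<in>insert i I. p j ((x(i := y)) j)) * g (x(i := y))"
      using insert.hyps by (simp add: mult.assoc)
  qed
  also have "\<dots> = (\<integral>\<^sup>+ x. (\<Prod>j\<in>insert i I. p j (x j)) * g x \<partial>PiM (insert i I) M)"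
    by (intro M.product_nn_integral_insert_rev[symmetric]) (simp_all del: prod.insert)
  finally show ?case .
qed

section \<open>Mixtures of uniform distributions and their inversion\<close>

lemma has_sum_unif_mass: "1 \<le> \<theta> \<Longrightarrow> (unif_mass \<theta> has_sum 1) UNIV"
  by (rule has_sum_finite_neutralI[of "{..<\<theta>}"]) (auto simp: unif_mass_def)

lemma unif_mass_le_one: "unif_mass \<theta> k \<le> 1"
  by (auto simp: unif_mass_def)

lemma unif_mass_nonneg: "0 \<le> unif_mass \<theta> k"
  by (auto simp: unif_mass_def)

context
  fixes f assumes f: "f \<in> mixing_pmfs"
begin

lemma coord_nonneg: "0 \<le> coord f \<theta>"
  using f by (cases "\<theta> = 0") (auto simp: mixing_pmfs_def)

lemma coord_has_sum: "(coord f has_sum 1) {1..}"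
  using f by (auto simp: mixing_pmfs_def)

text \<open>An \<open>infsum\<close> is 0 by default on a family that is not summable. Since uniform
  masses are at most 1, the series is dominated by \<open>coord f\<close>, so
  \<open>mixture_mass\<close> is a genuine sum.\<close>

lemma mixture_mass_has_sum: "((\<lambda>\<theta>. unif_mass \<theta> k * coord f \<theta>) has_sum mixture_mass f k) {1..}"
  unfolding mixture_mass_def
proof (rule has_sum_infsum, rule summable_on_comparison_test)
  show "coord f summable_on {1..}" using coord_has_sum by (rule has_sum_imp_summable)
qed (auto simp: coord_nonneg unif_mass_nonneg unif_mass_le_one mult_left_le_one_le)

lemma mixture_mass_nonneg: "0 \<le> mixture_mass f k"
  using mixture_mass_has_sum by (rule has_sum_nonneg) (auto simp: coord_nonneg unif_mass_nonneg)

text \<open>The uniform masses at \<open>k - 1\<close> and \<open>k\<close> agree for every \<theta>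
  except \<theta> = k, where they are 1/k and 0. The difference series therefore has a single term.
  This inversion is what makes the projection estimator unbiased in coordinates 1 to m.\<close>

lemma mixture_mass_diff:
  assumes "1 \<le> k"
  shows "real k * (mixture_mass f (k - 1) - mixture_mass f k) = coord f k"
proof -
  have "((\<lambda>\<theta>. unif_mass \<theta> (k - 1) * coord f \<theta> + (-1) * (unif_mass \<theta> k * coord f \<theta>))
      has_sum (mixture_mass f (k - 1) + (-1) * mixture_mass f k)) {1..}"
    by (intro has_sum_add has_sum_cmult_right mixture_mass_has_sum)
  moreover have "((\<lambda>\<theta>. unif_mass \<theta> (k - 1) * coord f \<theta> + (-1) * (unif_mass \<theta> k * coord f \<theta>))
      has_sum (coord f k / real k)) {1..}"
    using assms by (intro has_sum_finite_neutralI[of "{k}"]) (auto simp: unif_mass_def)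
  ultimately have "mixture_mass f (k - 1) + (-1) * mixture_mass f k = coord f k / real k"
    by (rule has_sum_unique)
  then show ?thesis using assms by (simp add: field_simps)
qed

text \<open>Tonelli for a nonnegative double series: summing over \<open>k\<close> first leaves the
  total mass of \<open>f\<close>, and swapping the order gives the total mass of the
  mixture.\<close>

lemma mixture_mass_has_sum_one: "(mixture_mass f has_sum 1) UNIV"
proof -
  have 1: "((\<lambda>k. unif_mass \<theta> k * coord f \<theta>) has_sum coord f \<theta>) UNIV" if "\<theta> \<in> {1..}" for \<theta>
    using has_sum_cmult_left[OF has_sum_unif_mass, of \<theta> "coord f \<theta>"] that by simp
  have "((\<lambda>(\<theta>, k). unif_mass \<theta> k * coord f \<theta>) has_sum 1) ({1..} \<times> UNIV)"
  proof (rule has_sum_SigmaI)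
    show "(\<lambda>(\<theta>, k). unif_mass \<theta> k * coord f \<theta>) summable_on ({1..} \<times> UNIV)"
      using 1 coord_has_sum
      by (intro summable_on_SigmaI[where g = "coord f"])
         (auto simp: coord_nonneg unif_mass_nonneg has_sum_imp_summable)
  qed (use 1 coord_has_sum in auto)
  then have "((\<lambda>(k, \<theta>). unif_mass \<theta> k * coord f \<theta>) has_sum 1) (UNIV \<times> {1..})"
    by (subst (asm) has_sum_swap) simp
  then show ?thesis
    by (rule has_sum_SigmaD) (use mixture_mass_has_sum in auto)
qed

lemma prob_space_mixture: "prob_space (mixture f)"
proof
  have "emeasure (mixture f) (space (mixture f)) = (\<Sum>k. ennreal (mixture_mass f k))"
    by (simp add: mixture_def emeasure_density nn_integral_count_space_nat)
  also have "\<dots> = 1"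
    using has_sum_imp_sums[OF mixture_mass_has_sum_one]
    by (subst suminf_ennreal_eq[OF mixture_mass_nonneg]) auto
  finally show "emeasure (mixture f) (space (mixture f)) = 1" .
qed

lemma measure_mixture_singleton: "measure (mixture f) {k} = mixture_mass f k"
  by (simp add: mixture_def measure_def emeasure_density nn_integral_count_space_indicator mixture_mass_nonneg)

end

section \<open>Risk and the two-point inequality\<close>

lemma sets_mixture [simp, measurable_cong]: "sets (mixture f) = UNIV"
  and space_mixture [simp]: "space (mixture f) = UNIV"
  by (simp_all add: mixture_def)

lemma borel_measurable_norm_estimator:
  assumes "T \<in> estimators n"
  shows "(\<lambda>x. ennreal ((norm (T x - f))\<^sup>2)) \<in> borel_measurable (PiM {..<n} (\<lambda>_. count_space UNIV))"
proof -
  have "(\<lambda>y. (norm (y - f))\<^sup>2) \<in> borel_measurable borel"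
    by (intro borel_measurable_continuous_onI continuous_intros)
  with assms show ?thesis
    unfolding estimators_def by measurable
qed

text \<open>Moves the dependence on \<open>f\<close> from the measure into the integrand. Risks at
  different \<open>f\<close> then share one integrator, product counting measure, and can be
  compared pointwise.\<close>

lemma risk_eq:
  assumes "f \<in> mixing_pmfs" and T: "T \<in> estimators n"
  shows "risk n T f = (\<integral>\<^sup>+ x. (\<Prod>i<n. ennreal (mixture_mass f (x i))) * ennreal ((norm (T x - f))\<^sup>2)
           \<partial>PiM {..<n} (\<lambda>_. count_space UNIV))"
  unfolding risk_def sample_def mixture_def
  using prob_space_mixture[OF assms(1)] 
  by (intro nn_integral_PiM_density borel_measurable_norm_estimator[OF T])
     (auto simp: mixture_def prob_space_imp_sigma_finite intro: sigma_finite_measure_count_space)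

text \<open>The minimum of the two one-point masses lies below both, so its product over the sample
  weighs both losses at once. No estimate is close to both \<open>f\<close> and \<open>g\<close>,
  which bounds the sum of the losses below. The finite set \<open>K\<close> lets the overlap be
  estimated by a finite sum.\<close>

lemma risk_add_ge:
  assumes f: "f \<in> mixing_pmfs" and g: "g \<in> mixing_pmfs" and T: "T \<in> estimators n"
    and K: "finite K" and q: "0 \<le> q" "q \<le> (\<Sum>k\<in>K. min (mixture_mass f k) (mixture_mass g k))"
  shows "ennreal ((norm (f - g))\<^sup>2 / 2 * q ^ n) \<le> risk n T f + risk n T g"
proof -
  interpret product_sigma_finite "\<lambda>_::nat. count_space (UNIV :: nat set)"
    by (rule product_sigma_finite.intro) (rule sigma_finite_measure_count_space)
  let ?M = "PiM {..<n} (\<lambda>_. count_space (UNIV :: nat set))"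
  let ?p = "\<lambda>k. ennreal (min (mixture_mass f k) (mixture_mass g k))"
  note [measurable] = borel_measurable_norm_estimator[OF T]
  have pm[measurable]: "(\<lambda>x. \<Prod>i<n. h (x i)) \<in> borel_measurable ?M" for h :: "nat \<Rightarrow> ennreal"
    by (intro borel_measurable_prod_ennreal measurable_compose[OF measurable_component_singleton]) simp_all
  have "ennreal q \<le> (\<Sum>k\<in>K. ?p k)"
    using q by (subst sum_ennreal) (auto simp: mixture_mass_nonneg f g intro: ennreal_leI)
  also have "\<dots> = (\<integral>\<^sup>+ k. ?p k \<partial>count_space K)"
    using K by (simp add: nn_integral_count_space_finite)
  also have "\<dots> \<le> (\<integral>\<^sup>+ k. ?p k \<partial>count_space UNIV)"
    by (subst nn_integral_count_space_indicator, simp, intro nn_integral_mono) (auto simp: indicator_def)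
  finally have q': "ennreal q \<le> (\<integral>\<^sup>+ k. ?p k \<partial>count_space UNIV)" .
  \<comment> \<open>Triangle inequality followed by (s + t)^2 <= 2 (s^2 + t^2); hence the factor
    1/2.\<close>
  have par: "(norm (f - g))\<^sup>2 / 2 \<le> (norm (y - f))\<^sup>2 + (norm (y - g))\<^sup>2" for y
  proof -
    have "(norm (f - g))\<^sup>2 \<le> (norm (y - f) + norm (y - g))\<^sup>2"
      using norm_triangle_ineq4[of "y - g" "y - f"] by (intro power_mono) (simp_all add: add.commute)
    also have "\<dots> \<le> 2 * ((norm (y - f))\<^sup>2 + (norm (y - g))\<^sup>2)"
      using sum_squares_bound[of "norm (y - f)" "norm (y - g)"] by (simp add: power2_sum)
    finally show ?thesis by simp
  qed
  have "ennreal ((norm (f - g))\<^sup>2 / 2 * q ^ n) = (\<Prod>i<n. ennreal q) * ennreal ((norm (f - g))\<^sup>2 / 2)"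
    using q by (simp add: ennreal_power mult.commute flip: ennreal_mult)
  also have "\<dots> \<le> (\<Prod>i<n. \<integral>\<^sup>+ k. ?p k \<partial>count_space UNIV) * ennreal ((norm (f - g))\<^sup>2 / 2)"
    by (intro mult_right_mono prod_mono_ennreal q') auto
  \<comment> \<open>The product of the minima factorises over the coordinates, so the overlap of a
    single observation enters to the power \<open>n\<close>.\<close>
  also have "\<dots> = (\<integral>\<^sup>+ x. (\<Prod>i<n. ?p (x i)) * ennreal ((norm (f - g))\<^sup>2 / 2) \<partial>?M)"
    by (subst nn_integral_multc[OF pm], subst product_nn_integral_prod) simp_all
  also have "\<dots> \<le> (\<integral>\<^sup>+ x. (\<Prod>i<n. ennreal (mixture_mass f (x i))) * ennreal ((norm (T x - f))\<^sup>2)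
      + (\<Prod>i<n. ennreal (mixture_mass g (x i))) * ennreal ((norm (T x - g))\<^sup>2) \<partial>?M)"
  proof (rule nn_integral_mono)
    fix x
    have "(\<Prod>i<n. ?p (x i)) * ennreal ((norm (f - g))\<^sup>2 / 2)
        \<le> (\<Prod>i<n. ?p (x i)) * (ennreal ((norm (T x - f))\<^sup>2) + ennreal ((norm (T x - g))\<^sup>2))"
      by (intro mult_left_mono) (use par in \<open>auto simp flip: ennreal_plus intro: ennreal_leI\<close>)
    also have "\<dots> \<le> (\<Prod>i<n. ennreal (mixture_mass f (x i))) * ennreal ((norm (T x - f))\<^sup>2)
      + (\<Prod>i<n. ennreal (mixture_mass g (x i))) * ennreal ((norm (T x - g))\<^sup>2)"
      unfolding distrib_left
      by (intro add_mono mult_right_mono prod_mono_ennreal ennreal_leI) auto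
    finally show "(\<Prod>i<n. ?p (x i)) * ennreal ((norm (f - g))\<^sup>2 / 2) \<le> \<dots>" .
  qed
  also have "\<dots> = risk n T f + risk n T g"
    unfolding risk_eq[OF f T] risk_eq[OF g T]
    by (intro nn_integral_add borel_measurable_times_ennreal pm borel_measurable_norm_estimator[OF T])
  finally show ?thesis .
qed

section \<open>Second moment of a sum of centred i.i.d. variables\<close>

lemma
  fixes g :: "'a \<Rightarrow> real"
  assumes "finite I" and N: "prob_space N" and g: "integrable N g" "(\<integral>y. g y \<partial>N) = 0"
    and g2: "integrable N (\<lambda>y. (g y)\<^sup>2)"
  shows integrable_PiM_sum_power2: "integrable (PiM I (\<lambda>_. N)) (\<lambda>x. (\<Sum>i\<in>I. g (x i))\<^sup>2)"
    and integral_PiM_sum_power2: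
      "(\<integral>x. (\<Sum>i\<in>I. g (x i))\<^sup>2 \<partial>PiM I (\<lambda>_. N)) = real (card I) * (\<integral>y. (g y)\<^sup>2 \<partial>N)"
proof -
  interpret N: prob_space N by (rule N)
  interpret product_sigma_finite "\<lambda>_. N"
    by (rule product_sigma_finite.intro) (rule N.sigma_finite_measure_axioms)
  \<comment> \<open>Writes g(x_i) g(x_j) as a product over all coordinates of \<open>I\<close>, the
    form required for integrating products. The two factors of \<open>h\<close> make coordinate i =
    j contribute the square of \<open>g\<close>; for distinct i and j a factor of mean zero kills
    the term.\<close>
  define h where "h i j l y = (if l = i then g y else 1) * (if l = j then g y else 1)" for i j l :: 'b and y
  have h_int: "integrable N (h i j l)" for i j l
    using g g2 unfolding h_def by (cases "l = i"; cases "l = j") (simp_all add: power2_eq_square)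
  have prod_h: "(\<Prod>l\<in>I. h i j l (x l)) = g (x i) * g (x j)" if "i \<in> I" "j \<in> I" for i j x
    using that \<open>finite I\<close> by (simp add: h_def prod.distrib)
  have sq: "(\<Sum>i\<in>I. g (x i))\<^sup>2 = (\<Sum>i\<in>I. \<Sum>j\<in>I. \<Prod>l\<in>I. h i j l (x l))" for x
    by (simp add: power2_eq_square sum_product prod_h)
  have prod_int: "integrable (PiM I (\<lambda>_. N)) (\<lambda>x. \<Prod>l\<in>I. h i j l (x l))" for i j
    using \<open>finite I\<close> h_int by (rule product_integrable_prod)
  show "integrable (PiM I (\<lambda>_. N)) (\<lambda>x. (\<Sum>i\<in>I. g (x i))\<^sup>2)"
    unfolding sq by (intro Bochner_Integration.integrable_sum prod_int)
  have E: "(\<integral>x. (\<Prod>l\<in>I. h i j l (x l)) \<partial>PiM I (\<lambda>_. N)) = (if j = i then \<integral>y. (g y)\<^sup>2 \<partial>N else 0)"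
    if "i \<in> I" "j \<in> I" for i j
  proof -
    have "(\<integral>x. (\<Prod>l\<in>I. h i j l (x l)) \<partial>PiM I (\<lambda>_. N)) = (\<Prod>l\<in>I. \<integral>y. h i j l y \<partial>N)"
      using \<open>finite I\<close> h_int by (rule product_integral_prod)
    also have "\<dots> = (if j = i then \<integral>y. (g y)\<^sup>2 \<partial>N else 0)"
    proof (cases "j = i")
      case True
      then have "(\<integral>y. h i j l y \<partial>N) = (if l = i then \<integral>y. (g y)\<^sup>2 \<partial>N else 1)" for l
        by (simp add: h_def power2_eq_square N.prob_space)
      with True that \<open>finite I\<close> show ?thesis by simp
    next
      case False
      then have "(\<integral>y. h i j i y \<partial>N) = 0" using g by (simp add: h_def)
      with False that \<open>finite I\<close> show ?thesis by (auto intro: prod_zero)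
    qed
    finally show ?thesis .
  qed
  show "(\<integral>x. (\<Sum>i\<in>I. g (x i))\<^sup>2 \<partial>PiM I (\<lambda>_. N)) = real (card I) * (\<integral>y. (g y)\<^sup>2 \<partial>N)"
    unfolding sq using \<open>finite I\<close> by (simp add: prod_int E)
qed

section \<open>Upper bound for the projection estimator\<close>

lemma coord_diff: "coord (x - y) k = coord x k - coord y k"
  unfolding minus_ell2_def plus_ell2.rep_eq uminus_ell2.rep_eq by simp

lemma norm_ell2_power2: "(norm x)\<^sup>2 = (\<Sum>\<^sub>\<infinity>k\<in>{1..}. (coord x k)\<^sup>2)"
  unfolding power2_norm_eq_inner inner_ell2_def by (simp only: power2_eq_square)

lemma emp_freq_eq_sum: "emp_freq n x k = (\<Sum>i<n. indicator {k} (x i)) / real n"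
proof -
  have "(\<Sum>i<n. indicator {k} (x i) :: real) = real (card ({..<n} \<inter> {i. x i = k}))"
    by (simp add: indicator_def sum.If_cases of_bool_def)
  also have "{..<n} \<inter> {i. x i = k} = {i. i < n \<and> x i = k}" by auto
  finally show ?thesis by (simp add: emp_freq_def)
qed

text \<open>The estimator vanishes beyond \<open>m\<close>, so there the error is the tail of
  \<open>f\<close> itself, the nonrandom squared bias.\<close>

lemma norm_projection_estimator_diff:
  "(norm (projection_estimator m n x - f))\<^sup>2
     = (\<Sum>k=1..m. (real k * (emp_freq n x (k - 1) - emp_freq n x k) - coord f k)\<^sup>2)
       + (\<Sum>\<^sub>\<infinity>k\<in>{m<..}. (coord f k)\<^sup>2)"
proof -
  let ?d = "\<lambda>k. (coord (projection_estimator m n x - f) k)\<^sup>2"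
  have U: "{1..} = {1..m} \<union> {m<..}" by auto
  have S: "?d summable_on {1..}" by (rule coord_summable)
  have "(norm (projection_estimator m n x - f))\<^sup>2 = infsum ?d {1..m} + infsum ?d {m<..}"
    unfolding norm_ell2_power2 U
    by (intro infsum_Un_disjoint summable_on_subset[OF S]) auto
  also have "infsum ?d {1..m} = (\<Sum>k=1..m. (real k * (emp_freq n x (k - 1) - emp_freq n x k) - coord f k)\<^sup>2)"
    by (simp add: coord_diff projection_estimator.rep_eq)
  also have "infsum ?d {m<..} = (\<Sum>\<^sub>\<infinity>k\<in>{m<..}. (coord f k)\<^sup>2)"
    by (intro infsum_cong) (simp add: coord_diff projection_estimator.rep_eq)
  finally show ?thesis .
qed

lemma risk_projection_estimator_le:
  assumes f: "f \<in> mixing_pmfs" and n: "1 \<le> n"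
  shows "risk n (projection_estimator m n) f
    \<le> ennreal ((\<Sum>\<^sub>\<infinity>k\<in>{m<..}. (coord f k)\<^sup>2) + 2 * (real m)\<^sup>2 / real n)"
proof -
  interpret N: prob_space "mixture f" by (rule prob_space_mixture[OF f])
  let ?P = "sample n f"
  interpret P: prob_space ?P
    unfolding sample_def by (intro prob_space_PiM N.prob_space_axioms)
  define Y :: "nat \<Rightarrow> nat \<Rightarrow> real" where "Y k y = indicator {k - 1} y - indicator {k} y" for k y
  define g where "g k y = Y k y - (\<integral>y. Y k y \<partial>mixture f)" for k y
  define t where "t = (\<Sum>\<^sub>\<infinity>k\<in>{m<..}. (coord f k)\<^sup>2)"
  have meas: "h \<in> borel_measurable (mixture f)" for h :: "nat \<Rightarrow> real"
    by (simp add: measurable_def)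
  have "\<bar>Y k y\<bar> \<le> 1" for k y
    by (simp add: Y_def indicator_def)
  then have Y_int: "integrable (mixture f) (\<lambda>y. (Y k y)^j)" for k j
    by (intro N.integrable_const_bound[where B = 1] AE_I2) (simp_all add: meas power_abs power_le_one)
  have EY: "(\<integral>y. Y k y \<partial>mixture f) = mixture_mass f (k - 1) - mixture_mass f k" for k
    unfolding Y_def by (simp add: measure_mixture_singleton[OF f] N.emeasure_eq_measure)
  have g_int: "integrable (mixture f) (g k)" and Eg: "(\<integral>y. g k y \<partial>mixture f) = 0" for k
    unfolding g_def using Y_int[of k 1] by (simp_all add: N.prob_space[simplified])
  have g2_int: "integrable (mixture f) (\<lambda>y. (g k y)\<^sup>2)" for k
    unfolding g_def power2_diff using Y_int[of k 1] Y_int[of k 2] by simp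
  have Eg2: "(\<integral>y. (g k y)\<^sup>2 \<partial>mixture f) \<le> mixture_mass f (k - 1) + mixture_mass f k" if "1 \<le> k" for k
  proof -
    \<comment> \<open>A variance is at most the second moment.\<close>
    have "(\<integral>y. (g k y)\<^sup>2 \<partial>mixture f) \<le> (\<integral>y. (Y k y)\<^sup>2 \<partial>mixture f)"
      unfolding g_def using Y_int[of k 1] Y_int[of k 2] by (subst N.variance_eq) auto
    \<comment> \<open>For k >= 1 the points \<open>k - 1\<close> and \<open>k\<close> are distinct
      and the cross term vanishes. At k = 0 truncated subtraction would make them coincide and
      \<open>Y\<close> would be zero.\<close>
    also have "\<dots> = (\<integral>y. indicator {k - 1} y + indicator {k} y \<partial>mixture f)"
      using that by (intro Bochner_Integration.integral_cong) (auto simp: Y_def indicator_def)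
    also have "\<dots> = mixture_mass f (k - 1) + mixture_mass f k"
      by (simp add: measure_mixture_singleton[OF f] N.emeasure_eq_measure)
    finally show ?thesis .
  qed
  \<comment> \<open>By the inversion formula the mean of the estimated coordinate is
    \<open>coord f k\<close>, so the error is a scaled sum of the centred variables
    \<open>g k\<close>.\<close>
  have err: "real k * (emp_freq n x (k - 1) - emp_freq n x k) - coord f k
      = real k / real n * (\<Sum>i<n. g k (x i))" if "1 \<le> k" for k x
  proof -
    have "(\<Sum>i<n. g k (x i)) = (\<Sum>i<n. Y k (x i)) - real n * (mixture_mass f (k - 1) - mixture_mass f k)"
      by (simp add: g_def EY sum_subtractf right_diff_distrib)
    also have "(\<Sum>i<n. Y k (x i)) = real n * (emp_freq n x (k - 1) - emp_freq n x k)"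
      using n by (simp add: Y_def sum_subtractf emp_freq_eq_sum field_simps)
    finally have eq: "(\<Sum>i<n. g k (x i)) = real n * (emp_freq n x (k - 1) - emp_freq n x k
        - (mixture_mass f (k - 1) - mixture_mass f k))"
      by (simp only: right_diff_distrib)
    show ?thesis
      unfolding eq using n by (simp add: right_diff_distrib flip: mixture_mass_diff[OF f that])
  qed
  have V_int: "integrable ?P (\<lambda>x. (\<Sum>i<n. g k (x i))\<^sup>2)" for k
    unfolding sample_def
    by (intro integrable_PiM_sum_power2 N.prob_space_axioms g_int Eg g2_int) simp
  have V: "(\<integral>x. (\<Sum>i<n. g k (x i))\<^sup>2 \<partial>?P) = real n * (\<integral>y. (g k y)\<^sup>2 \<partial>mixture f)" for k
    unfolding sample_def
    by (subst integral_PiM_sum_power2) (auto intro: N.prob_space_axioms g_int Eg g2_int)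
  have norm_eq: "(norm (projection_estimator m n x - f))\<^sup>2
      = (\<Sum>k=1..m. (real k / real n)\<^sup>2 * (\<Sum>i<n. g k (x i))\<^sup>2) + t" for x
    unfolding norm_projection_estimator_diff t_def power_mult_distrib[symmetric]
    by (intro arg_cong2[where f = "(+)"] sum.cong refl) (use err in auto)
  have partial: "sum (mixture_mass f) A \<le> 1" if "finite A" for A
    using has_sum_mono_neutral[OF has_sum_finite[OF that] mixture_mass_has_sum_one[OF f]]
    by (simp add: mixture_mass_nonneg[OF f])
  \<comment> \<open>The loss is a finite sum of integrable terms plus a constant, so the
    extended-valued risk is an ordinary integral.\<close>
  have risk: "risk n (projection_estimator m n) f
      = ennreal (\<integral>x. (norm (projection_estimator m n x - f))\<^sup>2 \<partial>?P)"
    unfolding risk_def norm_eq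
    by (intro nn_integral_eq_integral)
       (auto simp: V_int t_def intro!: add_nonneg_nonneg sum_nonneg infsum_nonneg)
  have E: "(\<integral>x. (norm (projection_estimator m n x - f))\<^sup>2 \<partial>?P)
      = (\<Sum>k=1..m. (real k / real n)\<^sup>2 * (real n * (\<integral>y. (g k y)\<^sup>2 \<partial>mixture f))) + t"
    unfolding norm_eq by (simp add: V_int V P.prob_space)
  \<comment> \<open>With \<open>k\<close> bounded by \<open>m\<close>, each mass of the mixture is
    counted at most twice, once as a left and once as a right neighbour. This is the 2 in the
    variance bound.\<close>
  have "(\<Sum>k=1..m. (real k / real n)\<^sup>2 * (real n * (\<integral>y. (g k y)\<^sup>2 \<partial>mixture f)))
      \<le> (\<Sum>k=1..m. (real m / real n)\<^sup>2 * (real n * (mixture_mass f (k - 1) + mixture_mass f k)))"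
    by (intro sum_mono mult_mono power_mono divide_right_mono Eg2) auto
  also have "\<dots> = (real m)\<^sup>2 / real n * ((\<Sum>k=1..m. mixture_mass f (k - 1)) + (\<Sum>k=1..m. mixture_mass f k))"
  proof -
    have "(real m / real n)\<^sup>2 * (real n * x) = (real m)\<^sup>2 / real n * x" for x
      using n by (simp add: power2_eq_square)
    then show ?thesis by (simp only: sum.distrib flip: sum_distrib_left)
  qed
  also have "(\<Sum>k=1..m. mixture_mass f (k - 1)) = sum (mixture_mass f) {..<m}"
    by (rule sum.reindex_bij_witness[of _ Suc "\<lambda>k. k - 1"]) auto
  also have "(real m)\<^sup>2 / real n * (sum (mixture_mass f) {..<m} + (\<Sum>k=1..m. mixture_mass f k))
      \<le> (real m)\<^sup>2 / real n * (1 + 1)"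
    by (intro mult_left_mono add_mono partial) auto
  finally show ?thesis
    unfolding risk E t_def by (intro ennreal_leI) (simp add: mult.commute)
qed

section \<open>Two-point lower bound\<close>

lift_definition spike :: "nat \<Rightarrow> real \<Rightarrow> ell2"
  is "\<lambda>m b k. if k = 0 then 0 else (if k = 1 then 1 - b else 0) + (if k = m then b else 0)"
proof -
  fix m :: nat and b :: real
  show "(if 0 = (0::nat) then 0 else (if 0 = (1::nat) then 1 - b else 0) + (if 0 = m then b else 0)) = 0 \<and>
    (\<lambda>k. (if k = 0 then 0 else (if k = 1 then 1 - b else 0) + (if k = m then b else 0))\<^sup>2) summable_on {1..}"
    by (auto intro!: has_sum_imp_summable[OF has_sum_finite_neutralI[of "{k\<in>{1, m}. 1 \<le> k}"]]
        split: if_splits)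
qed

lemma infsum_eq_sum_support:
  fixes h :: "nat \<Rightarrow> real"
  assumes "finite F" "F \<subseteq> A" "\<And>k. k \<in> A - F \<Longrightarrow> h k = 0"
  shows "infsum h A = sum h F"
  using assms by (intro infsumI has_sum_finite_neutralI) auto

lemma spike_mixing_pmfs:
  assumes "2 \<le> m" "0 \<le> b" "b \<le> 1"
  shows "spike m b \<in> mixing_pmfs"
  unfolding mixing_pmfs_def
proof (intro CollectI conjI)
  show "(coord (spike m b) has_sum 1) {1..}"
    using assms by (intro has_sum_finite_neutralI[of "{1, m}"]) (auto simp: spike.rep_eq)
qed (use assms in \<open>auto simp: spike.rep_eq\<close>)

lemma mixture_mass_spike:
  assumes "2 \<le> m"
  shows "mixture_mass (spike m b) k = (1 - b) * unif_mass 1 k + b * unif_mass m k"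
  unfolding mixture_mass_def
  using assms by (subst infsum_eq_sum_support[of "{1, m}"]) (auto simp: spike.rep_eq)

lemma norm_spike_diff:
  assumes "2 \<le> m" "2 \<le> m'" "m \<noteq> m'"
  shows "(norm (spike m b - spike m' b))\<^sup>2 = 2 * b\<^sup>2"
  unfolding norm_ell2_power2 coord_diff
  using assms by (subst infsum_eq_sum_support[of "{m, m'}"]) (auto simp: spike.rep_eq)

text \<open>Cutoffs satisfy k >= r >= 1, so the mass at 1 is never in a tail. The tail beyond
  \<open>k\<close> is the square of \<open>b\<close> if k < m and zero otherwise.\<close>

lemma spike_smoothness_class:
  assumes "2 \<le> m" "1 \<le> r" "\<And>k. k \<le> m \<Longrightarrow> b\<^sup>2 \<le> C\<^sup>2 * (u k)\<^sup>2"
  shows "spike m b \<in> smoothness_class u C r"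
  unfolding smoothness_class_def
proof (intro CollectI allI impI)
  fix k assume k: "r \<le> k"
  have "(\<Sum>\<^sub>\<infinity>j\<in>{k<..}. (coord (spike m b) j)\<^sup>2) = (\<Sum>j\<in>{m} \<inter> {k<..}. (coord (spike m b) j)\<^sup>2)"
    using assms k by (intro infsum_eq_sum_support) (auto simp: spike.rep_eq)
  also have "\<dots> \<le> C\<^sup>2 * (u k)\<^sup>2"
    using assms by (cases "k < m") (auto simp: spike.rep_eq)
  finally show "(\<Sum>\<^sub>\<infinity>j\<in>{k<..}. (coord (spike m b) j)\<^sup>2) \<le> C\<^sup>2 * (u k)\<^sup>2" .
qed

text \<open>On the first \<open>m\<close> points the smaller uniform mass is 1/(m + 1), so the
  overlap there is that of the common part 1 - b plus m b/(m + 1). What is lost is the mass that the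
  wider uniform puts on the point \<open>m\<close>.\<close>

lemma sum_min_mixture_mass_spike_ge:
  assumes "2 \<le> m" "0 \<le> b" "b \<le> 1"
  shows "1 - b / real (m + 1)
    \<le> (\<Sum>k<m. min (mixture_mass (spike m b) k) (mixture_mass (spike (m + 1) b) k))"
proof -
  have "1 - b / real (m + 1) = 1 - b + real m * (b / real (m + 1))"
    by (simp add: field_simps)
  also have "\<dots> = (\<Sum>k<m. (if k = 0 then 1 - b else 0) + b / real (m + 1))"
    using assms by (simp add: sum.distrib)
  also have "\<dots> \<le> (\<Sum>k<m. min (mixture_mass (spike m b) k) (mixture_mass (spike (m + 1) b) k))"
    using assms by (intro sum_mono) (auto simp: mixture_mass_spike unif_mass_def frac_le)
  finally show ?thesis .
qed

lemma minimax_risk_ge: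
  assumes anti: "decseq u" and pos: "\<And>m. 0 < u m" and "0 < C" "1 \<le> r" and m: "2 \<le> m"
    and small: "C * u (m + 1) \<le> 1" and T: "T \<in> estimators n"
  shows "ennreal ((C * u (m + 1) / 2)\<^sup>2 * (1 - sqrt 5 / (2 * real m) * C * u (m + 1)) ^ n)
    \<le> (SUP f\<in>smoothness_class u C r \<inter> mixing_pmfs. risk n T f)" (is "ennreal ?x \<le> ?S")
proof -
  define a where "a = C * u (m + 1)"
  \<comment> \<open>Makes the two spikes lie at distance exactly \<open>a\<close>, since the squared
    distance is twice the square of \<open>b\<close>.\<close>
  define b where "b = a / sqrt 2"
  define q where "q = 1 - sqrt 5 / (2 * real m) * a"
  have a: "0 < a" "a \<le> 1" using assms by (auto simp: a_def)
  have b2: "b\<^sup>2 = a\<^sup>2 / 2" by (simp add: b_def power_divide)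
  have b: "0 \<le> b" "b \<le> a" using a by (auto simp: b_def divide_le_eq)
  have s5: "2 \<le> sqrt 5" "sqrt 5 \<le> 4" by (auto intro: real_le_rsqrt real_le_lsqrt)
  \<comment> \<open>A crude bound on sqrt 5 together with a <= 1 and m >= 2 keeps \<open>q\<close>
    nonnegative, so it can serve as a lower bound for the overlap.\<close>
  have "sqrt 5 * a \<le> 4 * 1" using s5 a by (intro mult_mono) auto
  also have "\<dots> \<le> 2 * real m" using m by simp
  finally have q0: "0 \<le> q" using m by (simp add: q_def field_simps)
  \<comment> \<open>The overlap loss of this pair is at most a/m, and 1 <= sqrt 5 / 2 turns this
    into the stated constant.\<close>
  have "b / real (m + 1) \<le> a / real m" using b a m by (intro frac_le) auto
  also have "\<dots> = 2 / (2 * real m) * a" by simp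
  also have "\<dots> \<le> sqrt 5 / (2 * real m) * a"
    using s5 a by (intro mult_right_mono divide_right_mono) auto
  finally have "q \<le> 1 - b / real (m + 1)" by (simp add: q_def)
  also note sum_min_mixture_mass_spike_ge[OF m b(1) order_trans[OF b(2) a(2)]]
  finally have q1: "q \<le> (\<Sum>k<m. min (mixture_mass (spike m b) k) (mixture_mass (spike (m + 1) b) k))" .
  \<comment> \<open>Since \<open>u\<close> decreases, the bound at index \<open>m + 1\<close>
    carries over to all smaller indices, covering both spikes.\<close>
  have tail: "b\<^sup>2 \<le> C\<^sup>2 * (u k)\<^sup>2" if "k \<le> m + 1" for k
  proof -
    have "b\<^sup>2 \<le> a\<^sup>2" using b by (intro power_mono) auto
    also have "\<dots> \<le> (C * u k)\<^sup>2"
      using a \<open>0 < C\<close> decseqD[OF anti that] unfolding a_def by (intro power_mono mult_left_mono) simp_all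
    finally show ?thesis by (simp add: power_mult_distrib)
  qed
  have pmf: "spike j b \<in> mixing_pmfs" and smooth: "spike j b \<in> smoothness_class u C r"
    if "j \<in> {m, m + 1}" for j
  proof -
    have j: "2 \<le> j" "j \<le> m + 1" using that m by auto
    show "spike j b \<in> mixing_pmfs"
      using j a b by (intro spike_mixing_pmfs) auto
    show "spike j b \<in> smoothness_class u C r"
      using j \<open>1 \<le> r\<close> by (intro spike_smoothness_class tail) auto
  qed
  have "ennreal ((norm (spike m b - spike (m + 1) b))\<^sup>2 / 2 * q ^ n)
      \<le> risk n T (spike m b) + risk n T (spike (m + 1) b)"
    by (intro risk_add_ge[OF pmf pmf T _ q0 q1]) auto
  also have "\<dots> \<le> ?S + ?S"
    by (intro add_mono SUP_upper IntI pmf smooth) simp_all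
  also have "(norm (spike m b - spike (m + 1) b))\<^sup>2 = a\<^sup>2"
    using m by (simp add: norm_spike_diff b2)
  \<comment> \<open>The sum of two risks is at most twice the supremum, so half of a^2/2, namely
    (a/2)^2, is what remains.\<close>
  also have "a\<^sup>2 / 2 * q ^ n = ?x + ?x"
    by (simp add: q_def a_def power_divide mult.assoc)
  finally have 2: "ennreal (?x + ?x) \<le> ?S + ?S" .
  \<comment> \<open>Halving in the extended reals, by cases on whether the supremum is
    finite.\<close>
  have "ennreal x \<le> S" if "ennreal (x + x) \<le> S + S" "0 \<le> x" for x S
    using that by (cases S) (auto simp flip: ennreal_plus)
  from this[OF 2] show ?thesis
    by this (use q0 in \<open>simp add: q_def a_def mult.assoc\<close>)
qed

theorem theorem5:
  fixes u :: "nat \<Rightarrow> real" and C :: real and r :: nat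
  assumes "\<And>m. 0 < u m" and "decseq u" and "u \<longlonglongrightarrow> 0"
    and "0 < C" and "1 \<le> r"
  shows "(\<forall>\<^sub>F m in sequentially. \<forall>n\<ge>1.
            (INF T\<in>estimators n. SUP f\<in>smoothness_class u C r \<inter> mixing_pmfs. risk n T f)
              \<ge> ennreal ((C * u (m + 1) / 2)\<^sup>2
                   * (1 - sqrt 5 / (2 * real m) * C * u (m + 1)) ^ n))
       \<and> (\<forall>m\<ge>r. \<forall>n\<ge>1.
            (SUP f\<in>smoothness_class u C r \<inter> mixing_pmfs. risk n (projection_estimator m n) f)
              \<le> ennreal ((C * u m)\<^sup>2 + 2 * (real m)\<^sup>2 / real n))"
proof (intro conjI allI impI)
  \<comment> \<open>Large \<open>m\<close> means m >= 2 and C u(m + 1) < 1: the spikes then avoid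
    the point 1 and their mass \<open>b\<close> is at most 1.\<close>
  have "(\<lambda>m. C * u (m + 1)) \<longlonglongrightarrow> C * 0"
    using LIMSEQ_Suc[OF assms(3)] by (intro tendsto_mult_left) simp
  then have "\<forall>\<^sub>F m in sequentially. C * u (m + 1) < 1"
    by (rule order_tendstoD) simp
  with eventually_ge_at_top[of 2]
  show "\<forall>\<^sub>F m in sequentially. \<forall>n\<ge>1.
      (INF T\<in>estimators n. SUP f\<in>smoothness_class u C r \<inter> mixing_pmfs. risk n T f)
        \<ge> ennreal ((C * u (m + 1) / 2)\<^sup>2
             * (1 - sqrt 5 / (2 * real m) * C * u (m + 1)) ^ n)"
  proof eventually_elim
    case (elim m)
    then show ?case using assms by (intro allI impI INF_greatest minimax_risk_ge) auto
  qed
next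
  fix m n :: nat assume "r \<le> m" "1 \<le> n"
  show "(SUP f\<in>smoothness_class u C r \<inter> mixing_pmfs. risk n (projection_estimator m n) f)
      \<le> ennreal ((C * u m)\<^sup>2 + 2 * (real m)\<^sup>2 / real n)"
  proof (rule SUP_least)
    fix f assume f: "f \<in> smoothness_class u C r \<inter> mixing_pmfs"
    then have "(\<Sum>\<^sub>\<infinity>k\<in>{m<..}. (coord f k)\<^sup>2) \<le> (C * u m)\<^sup>2"
      using \<open>r \<le> m\<close> by (simp add: smoothness_class_def power_mult_distrib)
    with f \<open>1 \<le> n\<close> show "risk n (projection_estimator m n) f
        \<le> ennreal ((C * u m)\<^sup>2 + 2 * (real m)\<^sup>2 / real n)"
      by (intro order_trans[OF risk_projection_estimator_le] ennreal_leI add_right_mono) auto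
  qed
qed

end
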